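(* Let $\mathcal{C}$ and $\mathcal{D}$ be finitely based permutation classes. Then each of the three $2\times 2$ grid classes $$\operatorname{Grid}\begin{pmatrix}\mathcal{C}&\mathcal{D}\\ \operatorname{Av}(21)&\operatorname{Av}(21)\end{pmatrix},\quad \operatorname{Grid}\begin{pmatrix}\mathcal{C}&\mathcal{D}\\ \operatorname{Av}(21)&\operatorname{Av}(12)\end{pmatrix},\quad \operatorname{Grid}\begin{pmatrix}\mathcal{C}&\mathcal{D}\\ \operatorname{Av}(12)&\operatorname{Av}(21)\end{pmatrix}$$ is finitely based.
   Context: Permutations are identified with their plots $\{(i,\pi(i))\}$ in the plane. $\sigma\le\pi$ (containment) if some subsequence of $\pi$ is order-isomorphic to $\sigma$. A permutation class is a set of permutations closed downward under containment (the empty permutation belongs to every class). The basis of a class is the set of minimal permutations not in it; a class is finitely based if its basis is finite. $\operatorname{Av}(B)$ is the set of permutations containing no element of $B$; so $\operatorname{Av}(21)$ is the class of increasing permutations and $\operatorname{Av}(12)$ that of decreasing permutations. For a $2\times2$ matrix $\begin{pmatrix}\mathcal{A}&\mathcal{B}\\ \mathcal{E}&\mathcal{F}\end{pmatrix}$ of permutation classes, its grid class $\operatorname{Grid}$ is the set of permutations $\pi$ for which there exist one vertical and one horizontal line dividing the plot of $\pi$ into four rectangles such that the points of $\pi$ in the top-left, top-right, bottom-left and bottom-right rectangles form permutations in $\mathcal{A}$, $\mathcal{B}$, $\mathcal{E}$, $\mathcal{F}$ respectively. *)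

theory Defs
  imports "HOL-Library.Sublist" "HOL-Combinatorics.Multiset_Permutations"
begin

text \<open>A permutation of length \<open>n\<close> is the list of its values \<open>\<pi>(1), \<dots>, \<pi>(n)\<close>;
  the list \<open>[]\<close> is the empty permutation.\<close>

definition perms :: "nat list set" where
  "perms = (\<Union>n. permutations_of_set {1..n})"

definition order_isomorphic :: "nat list \<Rightarrow> nat list \<Rightarrow> bool" where
  "order_isomorphic xs ys \<longleftrightarrow> length xs = length ys \<and>
     (\<forall>i<length xs. \<forall>j<length xs. xs ! i < xs ! j \<longleftrightarrow> ys ! i < ys ! j)"

definition contained_in :: "nat list \<Rightarrow> nat list \<Rightarrow> bool" where
  "contained_in \<sigma> \<pi> \<longleftrightarrow> (\<exists>xs. subseq xs \<pi> \<and> order_isomorphic xs \<sigma>)"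

definition perm_class :: "nat list set \<Rightarrow> bool" where
  "perm_class \<C> \<longleftrightarrow> \<C> \<subseteq> perms \<and> [] \<in> \<C> \<and>
     (\<forall>\<pi>\<in>\<C>. \<forall>\<sigma>\<in>perms. contained_in \<sigma> \<pi> \<longrightarrow> \<sigma> \<in> \<C>)"

definition basis :: "nat list set \<Rightarrow> nat list set" where
  "basis \<C> = {\<beta> \<in> perms - \<C>. \<forall>\<sigma>\<in>perms - \<C>. contained_in \<sigma> \<beta> \<longrightarrow> \<sigma> = \<beta>}"

definition finitely_based_class :: "nat list set \<Rightarrow> bool" where
  "finitely_based_class \<C> \<longleftrightarrow> perm_class \<C> \<and> finite (basis \<C>)"

definition Av :: "nat list set \<Rightarrow> nat list set" where
  "Av B = {\<pi> \<in> perms. \<forall>\<beta>\<in>B. \<not> contained_in \<beta> \<pi>}"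

text \<open>A sequence of distinct values, such as the values of the points in a cell of a gridding read
  from left to right, forms the permutation to which it is order-isomorphic.\<close>

definition forms_perm_in :: "nat list \<Rightarrow> nat list set \<Rightarrow> bool" where
  "forms_perm_in xs \<C> \<longleftrightarrow> (\<exists>\<sigma>\<in>\<C>. order_isomorphic xs \<sigma>)"

text \<open>The arguments of \<open>Grid\<close> are the top-left, top-right, bottom-left and bottom-right entries of
  the matrix. The dividing lines are \<open>x = k + 1/2\<close> and \<open>y = h + 1/2\<close>; as points of a plot
  have positive integer coordinates, these give every division of the plot by a vertical
  and a horizontal line that avoid its points. Cells may be empty.\<close>

definition Grid ::
  "nat list set \<Rightarrow> nat list set \<Rightarrow> nat list set \<Rightarrow> nat list set \<Rightarrow> nat list set" where
  "Grid \<A> \<B> \<E> \<F> = {\<pi> \<in> perms. \<exists>k h.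
     forms_perm_in (filter (\<lambda>y. h < y) (take k \<pi>)) \<A> \<and>
     forms_perm_in (filter (\<lambda>y. h < y) (drop k \<pi>)) \<B> \<and>
     forms_perm_in (filter (\<lambda>y. y \<le> h) (take k \<pi>)) \<E> \<and>
     forms_perm_in (filter (\<lambda>y. y \<le> h) (drop k \<pi>)) \<F>}"

end

theory Submission
  imports Defs
begin

text \<open>A permutation outside the grid class carries, for every pair of a vertical line \<open>k\<close> and a
  horizontal line \<open>h\<close>, an obstruction: a basis element in a top cell or a forbidden pair in a bottom
  cell. It is enough to find boundedly many of these obstructions that rule out all pairs \<open>(k, h)\<close>.
  For a fixed \<open>h\<close>, the left cells only bound \<open>k\<close> from above and the right cells only from below, so
  two obstructions, one on each side, rule out \<open>h\<close>. Raising \<open>h\<close> preserves a clash of two bottom pairs,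
  lowering \<open>h\<close> preserves a clash of two top obstructions. For a forbidden bottom pair on one side and a
  top obstruction on the other, either the lowest point of the top obstruction yields a new
  forbidden bottom pair, and all larger \<open>h\<close> are ruled out at no further cost, or one lowest
  forbidden pair can serve for all \<open>h\<close> at once; this is where the shape of the bottom row matters.\<close>

section \<open>Bounded sets of obstructions\<close>

text \<open>The set \<open>P\<close> consists of the points of a plot, identified with their heights; \<open>x p\<close> is the
  column of \<open>p\<close>. The predicates \<open>A\<close> and \<open>B\<close> describe the top cells, and \<open>incE\<close> and \<open>incF\<close> tell
  whether the bottom cells are increasing or decreasing.\<close>

locale plot_gridding =
  fixes P :: "nat set" and x :: "nat \<Rightarrow> nat" and A B :: "nat set \<Rightarrow> bool"
    and incE incF :: bool and N :: nat
  assumes finite_P: "finite P" and inj_x: "inj_on x P"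
    and A_empty: "A {}" and B_empty: "B {}"
    and A_mono: "\<And>S T. S \<subseteq> T \<Longrightarrow> A T \<Longrightarrow> A S" and B_mono: "\<And>S T. S \<subseteq> T \<Longrightarrow> B T \<Longrightarrow> B S"
    and A_small: "\<And>T. \<not> A T \<Longrightarrow> \<exists>S\<subseteq>T. finite S \<and> card S \<le> N \<and> \<not> A S"
    and B_small: "\<And>T. \<not> B T \<Longrightarrow> \<exists>S\<subseteq>T. finite S \<and> card S \<le> N \<and> \<not> B S"
begin

definition bad :: "bool \<Rightarrow> nat \<Rightarrow> nat \<Rightarrow> bool" where
  "bad inc u v \<longleftrightarrow> x u < x v \<and> (if inc then v < u else u < v)"

text \<open>The vertical line \<open>k\<close> runs just before column \<open>k\<close>. Since
  \<open>u\<close> is the left point of a bad pair, testing the column of \<open>v\<close> puts both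
  points into the left cell; \<open>right_fail\<close> dually tests only \<open>u\<close>.\<close>

definition left_fail :: "nat set \<Rightarrow> nat \<Rightarrow> nat \<Rightarrow> bool" where
  "left_fail T k h \<longleftrightarrow> \<not> A {p \<in> T. x p < k \<and> h < p} \<or>
     (\<exists>u\<in>T. \<exists>v\<in>T. bad incE u v \<and> x v < k \<and> u \<le> h \<and> v \<le> h)"

definition right_fail :: "nat set \<Rightarrow> nat \<Rightarrow> nat \<Rightarrow> bool" where
  "right_fail T k h \<longleftrightarrow> \<not> B {p \<in> T. k \<le> x p \<and> h < p} \<or>
     (\<exists>u\<in>T. \<exists>v\<in>T. bad incF u v \<and> k \<le> x u \<and> u \<le> h \<and> v \<le> h)"

definition no_cut :: "nat set \<Rightarrow> nat \<Rightarrow> bool" where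
  "no_cut T h \<longleftrightarrow> (\<forall>k. left_fail T k h \<or> right_fail T k h)"

text \<open>The letters name the two cells whose obstructions together leave no vertical line.\<close>

definition clash_EF :: "nat set \<Rightarrow> nat \<Rightarrow> bool" where
  "clash_EF T h \<longleftrightarrow> (\<exists>u\<in>T. \<exists>v\<in>T. \<exists>u'\<in>T. \<exists>v'\<in>T. bad incE u v \<and> bad incF u' v' \<and> x v \<le> x u' \<and>
     u \<le> h \<and> v \<le> h \<and> u' \<le> h \<and> v' \<le> h)"

definition clash_EB :: "nat set \<Rightarrow> nat \<Rightarrow> bool" where
  "clash_EB T h \<longleftrightarrow> (\<exists>u\<in>T. \<exists>v\<in>T. bad incE u v \<and> u \<le> h \<and> v \<le> h \<and> \<not> B {p \<in> T. x v \<le> x p \<and> h < p})"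

definition clash_AF :: "nat set \<Rightarrow> nat \<Rightarrow> bool" where
  "clash_AF T h \<longleftrightarrow> (\<exists>u\<in>T. \<exists>v\<in>T. bad incF u v \<and> u \<le> h \<and> v \<le> h \<and> \<not> A {p \<in> T. x p \<le> x u \<and> h < p})"

definition clash_AB :: "nat set \<Rightarrow> nat \<Rightarrow> bool" where
  "clash_AB T h \<longleftrightarrow> (\<exists>j. \<not> A {p \<in> T. x p \<le> j \<and> h < p} \<and> \<not> B {p \<in> T. j \<le> x p \<and> h < p})"

text \<open>One set must serve all rows from \<open>h\<close> upwards. The budget
  \<open>4 + 2 * N\<close> is common to all types of clash: at most two bottom pairs and at most two
  top obstructions.\<close>

definition blocked_above :: "nat \<Rightarrow> bool" where
  "blocked_above h \<longleftrightarrow> (\<exists>T\<subseteq>P. card T \<le> 4 + 2 * N \<and> (\<forall>h'\<ge>h. no_cut T h'))"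

section \<open>Clashes and the absence of a vertical line\<close>

lemma not_A_mono: "\<not> A S \<Longrightarrow> S \<subseteq> T \<Longrightarrow> \<not> A T"
  using A_mono by blast

lemma not_B_mono: "\<not> B S \<Longrightarrow> S \<subseteq> T \<Longrightarrow> \<not> B T"
  using B_mono by blast

lemma no_cut_mono:
  assumes "S \<subseteq> T" "no_cut S h"
  shows "no_cut T h"
proof -
  have "left_fail T k h" if "left_fail S k h" for k
  proof -
    have "{p \<in> S. x p < k \<and> h < p} \<subseteq> {p \<in> T. x p < k \<and> h < p}"
      using assms(1) by auto
    then show ?thesis
      using that assms(1) A_mono unfolding left_fail_def by (meson subsetD)
  qed
  moreover have "right_fail T k h" if "right_fail S k h" for k
  proof -
    have "{p \<in> S. k \<le> x p \<and> h < p} \<subseteq> {p \<in> T. k \<le> x p \<and> h < p}"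
      using assms(1) by auto
    then show ?thesis
      using that assms(1) B_mono unfolding right_fail_def by (meson subsetD)
  qed
  ultimately show ?thesis
    using assms(2) unfolding no_cut_def by blast
qed

text \<open>The two obstructions may share a column: a line \<open>k\<close> with
  \<open>x v < k\<close> meets the left one, and any other line has \<open>x u'\<close> on its
  right. The next three lemmas follow the same split.\<close>

lemma clash_EF_no_cut:
  assumes "clash_EF T h"
  shows "no_cut T h"
proof -
  obtain u v u' v' where *: "u \<in> T" "v \<in> T" "u' \<in> T" "v' \<in> T" "bad incE u v" "bad incF u' v'"
    "x v \<le> x u'" "u \<le> h" "v \<le> h" "u' \<le> h" "v' \<le> h"
    using assms unfolding clash_EF_def by blast
  have "left_fail T k h" if "x v < k" for k
    using * that unfolding left_fail_def by blast
  moreover have "right_fail T k h" if "\<not> x v < k" for k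
  proof -
    have "k \<le> x u'" using that *(7) by linarith
    then show ?thesis using * unfolding right_fail_def by blast
  qed
  ultimately show ?thesis
    unfolding no_cut_def by blast
qed

lemma clash_EB_no_cut:
  assumes "clash_EB T h"
  shows "no_cut T h"
proof -
  obtain u v where *: "u \<in> T" "v \<in> T" "bad incE u v" "u \<le> h" "v \<le> h"
    "\<not> B {p \<in> T. x v \<le> x p \<and> h < p}"
    using assms unfolding clash_EB_def by blast
  have "left_fail T k h" if "x v < k" for k
    using * that unfolding left_fail_def by blast
  moreover have "right_fail T k h" if "\<not> x v < k" for k
  proof -
    have "\<not> B {p \<in> T. k \<le> x p \<and> h < p}"
      by (rule not_B_mono[OF *(6)]) (use that in auto)
    then show ?thesis unfolding right_fail_def by blast
  qed
  ultimately show ?thesis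
    unfolding no_cut_def by blast
qed

lemma clash_AF_no_cut:
  assumes "clash_AF T h"
  shows "no_cut T h"
proof -
  obtain u v where *: "u \<in> T" "v \<in> T" "bad incF u v" "u \<le> h" "v \<le> h"
    "\<not> A {p \<in> T. x p \<le> x u \<and> h < p}"
    using assms unfolding clash_AF_def by blast
  have "right_fail T k h" if "k \<le> x u" for k
    using * that unfolding right_fail_def by blast
  moreover have "left_fail T k h" if "\<not> k \<le> x u" for k
  proof -
    have "\<not> A {p \<in> T. x p < k \<and> h < p}"
      by (rule not_A_mono[OF *(6)]) (use that in auto)
    then show ?thesis unfolding left_fail_def by blast
  qed
  ultimately show ?thesis
    unfolding no_cut_def by blast
qed

lemma clash_AB_no_cut:
  assumes "clash_AB T h"
  shows "no_cut T h"
proof -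
  obtain j where *: "\<not> A {p \<in> T. x p \<le> j \<and> h < p}" "\<not> B {p \<in> T. j \<le> x p \<and> h < p}"
    using assms unfolding clash_AB_def by blast
  have "right_fail T k h" if "k \<le> j" for k
  proof -
    have "\<not> B {p \<in> T. k \<le> x p \<and> h < p}"
      by (rule not_B_mono[OF *(2)]) (use that in auto)
    then show ?thesis unfolding right_fail_def by blast
  qed
  moreover have "left_fail T k h" if "\<not> k \<le> j" for k
  proof -
    have "\<not> A {p \<in> T. x p < k \<and> h < p}"
      by (rule not_A_mono[OF *(1)]) (use that in auto)
    then show ?thesis unfolding left_fail_def by blast
  qed
  ultimately show ?thesis
    unfolding no_cut_def by blast
qed

text \<open>Moving the line to the right, stop where the left side first fails, at
  \<open>Suc j\<close>. At \<open>j\<close> the left side holds, so the right side fails. The left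
  obstruction uses columns up to \<open>j\<close>, the right one columns from \<open>j\<close> on,
  and the four combinations are the four clashes.\<close>

lemma no_cut_clash:
  assumes "no_cut P h"
  shows "clash_EF P h \<or> clash_EB P h \<or> clash_AF P h \<or> clash_AB P h"
proof -
  \<comment> \<open>Behind the last column the right cells are empty, so the failure there is on the
    left and a least such \<open>k\<close> exists.\<close>
  obtain K where K: "\<And>p. p \<in> P \<Longrightarrow> x p < K"
    using finite_nat_set_iff_bounded[of "x ` P"] finite_P by auto
  have "\<not> right_fail P K h"
  proof -
    have e: "{p \<in> P. K \<le> x p \<and> h < p} = {}"
      using K by (auto simp: not_le)
    show ?thesis
      unfolding right_fail_def e using B_empty K by (auto simp: not_le)
  qed
  then have K_fail: "left_fail P K h"
    using assms unfolding no_cut_def by blast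
  define k where "k = (LEAST k. left_fail P k h)"
  have k: "left_fail P k h"
    unfolding k_def using K_fail by (rule LeastI)
  \<comment> \<open>For \<open>k = 0\<close> the left cells are empty, hence the least failing
    \<open>k\<close> is a successor.\<close>
  have "\<not> left_fail P 0 h"
    using A_empty unfolding left_fail_def by simp
  then obtain j where j: "k = Suc j"
    using k by (cases k) auto
  have "\<not> left_fail P j h"
    using not_less_Least[of j "\<lambda>k. left_fail P k h"] j unfolding k_def by simp
  then have r: "right_fail P j h"
    using assms unfolding no_cut_def by blast
  have l: "left_fail P (Suc j) h"
    using k j by simp
  from l[unfolded left_fail_def less_Suc_eq_le] r[unfolded right_fail_def] show ?thesis
  proof (elim disjE bexE conjE)
    assume "\<not> A {p \<in> P. x p \<le> j \<and> h < p}" "\<not> B {p \<in> P. j \<le> x p \<and> h < p}"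
    then show ?thesis unfolding clash_AB_def by blast
  next
    fix u v assume *: "\<not> A {p \<in> P. x p \<le> j \<and> h < p}" "u \<in> P" "v \<in> P" "bad incF u v"
      "j \<le> x u" "u \<le> h" "v \<le> h"
    have "\<not> A {p \<in> P. x p \<le> x u \<and> h < p}"
      by (rule not_A_mono[OF *(1)]) (use * in auto)
    then show ?thesis using * unfolding clash_AF_def by blast
  next
    fix u v assume *: "\<not> B {p \<in> P. j \<le> x p \<and> h < p}" "u \<in> P" "v \<in> P" "bad incE u v"
      "x v \<le> j" "u \<le> h" "v \<le> h"
    have "\<not> B {p \<in> P. x v \<le> x p \<and> h < p}"
      by (rule not_B_mono[OF *(1)]) (use * in auto)
    then show ?thesis using * unfolding clash_EB_def by blast
  next
    fix u v u' v' assume "u \<in> P" "v \<in> P" "bad incE u v" "x v \<le> j" "u \<le> h" "v \<le> h"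
      "u' \<in> P" "v' \<in> P" "bad incF u' v'" "j \<le> x u'" "u' \<le> h" "v' \<le> h"
    then show ?thesis unfolding clash_EF_def by (meson order_trans)
  qed
qed

section \<open>Clashes that rule out all higher rows\<close>

lemma clash_EF_blocked:
  assumes "clash_EF P h"
  shows "blocked_above h"
proof -
  obtain u v u' v' where *: "u \<in> P" "v \<in> P" "u' \<in> P" "v' \<in> P" "bad incE u v" "bad incF u' v'"
    "x v \<le> x u'" "u \<le> h" "v \<le> h" "u' \<le> h" "v' \<le> h"
    using assms unfolding clash_EF_def by blast
  have "clash_EF {u, v, u', v'} h'" if "h \<le> h'" for h'
    unfolding clash_EF_def using * that
    by (intro bexI[of _ u] bexI[of _ v] bexI[of _ u'] bexI[of _ v']) auto
  moreover have "card {u, v, u', v'} \<le> 4 + 2 * N"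
    using card_length[of "[u, v, u', v']"] by simp
  ultimately show ?thesis
    unfolding blocked_above_def using * clash_EF_no_cut
    by (intro exI[of _ "{u, v, u', v'}"]) auto
qed

lemma card_pair_Un: "card S \<le> N \<Longrightarrow> card ({u, v} \<union> S) \<le> 4 + 2 * N"
  using card_Un_le[of "{u, v}" S] card_length[of "[u, v]"] by simp

text \<open>The lowest point of the obstruction in the top right cell makes a forbidden pair with the
  right point of the forbidden pair on the left.\<close>

lemma clash_EB_blocked:
  assumes "\<not> incF" "clash_EB P h"
  shows "blocked_above h"
proof -
  obtain u v where *: "u \<in> P" "v \<in> P" "bad incE u v" "u \<le> h" "v \<le> h"
    "\<not> B {p \<in> P. x v \<le> x p \<and> h < p}"
    using assms unfolding clash_EB_def by blast
  obtain S where S: "S \<subseteq> {p \<in> P. x v \<le> x p \<and> h < p}" "finite S" "card S \<le> N" "\<not> B S"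
    using B_small[OF *(6)] by blast
  have "S \<noteq> {}" using S(4) B_empty by auto
  then have m: "Min S \<in> S" using S(2) by simp
  then have mP: "Min S \<in> P" "x v \<le> x (Min S)" "h < Min S" using S(1) by auto
  then have "x v \<noteq> x (Min S)"
    using inj_onD[OF inj_x, of v "Min S"] * by auto
  then have bad_m: "bad incF v (Min S)"
    using mP * assms(1) unfolding bad_def by auto
  let ?T = "{u, v} \<union> S"
  \<comment> \<open>Below \<open>Min S\<close> all of \<open>S\<close> is still above the row; from
    \<open>Min S\<close> on, the pair \<open>(v, Min S)\<close> takes over in the bottom right
    cell.\<close>
  have "no_cut ?T h'" if "h \<le> h'" for h'
  proof (cases "h' < Min S")
    case True
    have "\<not> B {p \<in> ?T. x v \<le> x p \<and> h' < p}"
    proof (rule not_B_mono[OF S(4)], rule)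
      fix p assume "p \<in> S"
      then show "p \<in> {p \<in> ?T. x v \<le> x p \<and> h' < p}"
        using S(1) Min_le[OF S(2)] True by fastforce
    qed
    moreover have "u \<le> h'" "v \<le> h'" using * that by auto
    ultimately have "clash_EB ?T h'"
      unfolding clash_EB_def using *(3) by blast
    then show ?thesis by (rule clash_EB_no_cut)
  next
    case False
    moreover have "u \<le> h'" "v \<le> h'" using * that by auto
    ultimately have "clash_EF ?T h'"
      unfolding clash_EF_def using *(3) bad_m m
      by (intro bexI[of _ u] bexI[of _ v] bexI[of _ "Min S"]) auto
    then show ?thesis by (rule clash_EF_no_cut)
  qed
  then show ?thesis
    unfolding blocked_above_def using * S(1) card_pair_Un[OF S(3)]
    by (intro exI[of _ ?T]) auto
qed

text \<open>Mirror image of \<open>clash_EB_blocked\<close>: the lowest point of the top left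
  obstruction is to the left of \<open>u\<close> and above it, so it forms a descent with
  \<open>u\<close>, which an increasing left cell forbids.\<close>

lemma clash_AF_blocked:
  assumes "incE" "clash_AF P h"
  shows "blocked_above h"
proof -
  obtain u v where *: "u \<in> P" "v \<in> P" "bad incF u v" "u \<le> h" "v \<le> h"
    "\<not> A {p \<in> P. x p \<le> x u \<and> h < p}"
    using assms unfolding clash_AF_def by blast
  obtain S where S: "S \<subseteq> {p \<in> P. x p \<le> x u \<and> h < p}" "finite S" "card S \<le> N" "\<not> A S"
    using A_small[OF *(6)] by blast
  have "S \<noteq> {}" using S(4) A_empty by auto
  then have m: "Min S \<in> S" using S(2) by simp
  then have mP: "Min S \<in> P" "x (Min S) \<le> x u" "h < Min S" using S(1) by auto
  then have "x u \<noteq> x (Min S)"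
    using inj_onD[OF inj_x, of u "Min S"] * by auto
  then have bad_m: "bad incE (Min S) u"
    using mP * assms(1) unfolding bad_def by auto
  let ?T = "{u, v} \<union> S"
  have "no_cut ?T h'" if "h \<le> h'" for h'
  proof (cases "h' < Min S")
    case True
    have "\<not> A {p \<in> ?T. x p \<le> x u \<and> h' < p}"
    proof (rule not_A_mono[OF S(4)], rule)
      fix p assume "p \<in> S"
      then show "p \<in> {p \<in> ?T. x p \<le> x u \<and> h' < p}"
        using S(1) Min_le[OF S(2)] True by fastforce
    qed
    moreover have "u \<le> h'" "v \<le> h'" using * that by auto
    ultimately have "clash_AF ?T h'"
      unfolding clash_AF_def using *(3) by blast
    then show ?thesis by (rule clash_AF_no_cut)
  next
    case False
    moreover have "u \<le> h'" "v \<le> h'" using * that by auto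
    ultimately have "clash_EF ?T h'"
      unfolding clash_EF_def using *(3) bad_m m
      by (intro bexI[of _ "Min S"] bexI[of _ u] bexI[of _ v]) auto
    then show ?thesis by (rule clash_EF_no_cut)
  qed
  then show ?thesis
    unfolding blocked_above_def using * S(1) card_pair_Un[OF S(3)]
    by (intro exI[of _ ?T]) auto
qed

section \<open>One bounded set for all clashes of a type\<close>

text \<open>Lets the highest row with a given clash be chosen by \<open>Max\<close>: a top
  obstruction is nonempty, so some point lies above the row.\<close>

lemma finite_clash_rows:
  assumes "\<And>h. h \<in> X \<Longrightarrow> \<exists>p\<in>P. h < p"
  shows "finite X"
proof (rule finite_subset)
  show "X \<subseteq> (\<Union>p\<in>P. {..<p})" using assms by auto
  show "finite (\<Union>p\<in>P. {..<p})" using finite_P by simp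
qed

lemma not_A_point: "\<not> A {p \<in> P. Q p} \<Longrightarrow> \<exists>p\<in>P. Q p"
  using A_empty A_mono[of "{p \<in> P. Q p}" "{}"] by blast

lemma not_B_point: "\<not> B {p \<in> P. Q p} \<Longrightarrow> \<exists>p\<in>P. Q p"
  using B_empty B_mono[of "{p \<in> P. Q p}" "{}"] by blast

text \<open>The obstructions for the highest such row \<open>h0\<close> lie above every lower row as
  well, so they serve for all of them.\<close>

lemma clash_AB_cover:
  "\<exists>T\<subseteq>P. card T \<le> 4 + 2 * N \<and> (\<forall>h. clash_AB P h \<longrightarrow> no_cut T h)"
proof (cases "\<exists>h. clash_AB P h")
  case False
  then show ?thesis by (intro exI[of _ "{}"]) auto
next
  case True
  let ?X = "{h. clash_AB P h}"
  have fin: "finite ?X"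
    by (rule finite_clash_rows) (auto simp: clash_AB_def dest!: not_A_point)
  define h0 where "h0 = Max ?X"
  have h0: "clash_AB P h0"
    using Max_in[OF fin] True unfolding h0_def by auto
  then obtain j where *: "\<not> A {p \<in> P. x p \<le> j \<and> h0 < p}" "\<not> B {p \<in> P. j \<le> x p \<and> h0 < p}"
    unfolding clash_AB_def by blast
  obtain S where S: "S \<subseteq> {p \<in> P. x p \<le> j \<and> h0 < p}" "finite S" "card S \<le> N" "\<not> A S"
    using A_small[OF *(1)] by blast
  obtain S' where S': "S' \<subseteq> {p \<in> P. j \<le> x p \<and> h0 < p}" "finite S'" "card S' \<le> N" "\<not> B S'"
    using B_small[OF *(2)] by blast
  have "no_cut (S \<union> S') h" if "clash_AB P h" for h
  proof -
    have "h \<le> h0" using Max_ge[OF fin] that unfolding h0_def by simp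
    have "\<not> A {p \<in> S \<union> S'. x p \<le> j \<and> h < p}"
      by (rule not_A_mono[OF S(4)]) (use S(1) \<open>h \<le> h0\<close> in auto)
    moreover have "\<not> B {p \<in> S \<union> S'. j \<le> x p \<and> h < p}"
      by (rule not_B_mono[OF S'(4)]) (use S'(1) \<open>h \<le> h0\<close> in auto)
    ultimately show ?thesis
      by (intro clash_AB_no_cut) (auto simp: clash_AB_def)
  qed
  moreover have "card (S \<union> S') \<le> 4 + 2 * N"
    using card_Un_le[of S S'] S(3) S'(3) by simp
  ultimately show ?thesis
    using S(1) S'(1) by (intro exI[of _ "S \<union> S'"]) auto
qed

text \<open>A forbidden pair whose right point \<open>v\<close> lies left of \<open>q\<close> makes \<open>(v, q)\<close> or \<open>(p, q)\<close> a forbidden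
  pair on the right with no room for a vertical line.\<close>

lemma lowest_bad_E_pair:
  assumes "incF" "u0 \<in> P" "v0 \<in> P" "bad incE u0 v0"
  obtains p q where "p \<in> P" "q \<in> P" "bad incE p q"
    "\<And>u v. u \<in> P \<Longrightarrow> v \<in> P \<Longrightarrow> bad incE u v \<Longrightarrow>
       max p q \<le> max u v \<and> (x q \<le> x v \<or> clash_EF P (max u v))"
proof -
  let ?Q = "\<lambda>e. fst e \<in> P \<and> snd e \<in> P \<and> bad incE (fst e) (snd e)"
  let ?ht = "\<lambda>e. max (fst e) (snd e)"
  \<comment> \<open>Choose a pair of minimal height, and among those one whose right point is
    furthest left.\<close>
  obtain e0 where e0: "?Q e0" "\<And>e. ?Q e \<Longrightarrow> ?ht e0 \<le> ?ht e"
    using ex_has_least_nat[of ?Q "(u0, v0)" ?ht] assms by auto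
  obtain e where e: "?Q e \<and> ?ht e = ?ht e0"
    "\<And>e'. ?Q e' \<and> ?ht e' = ?ht e0 \<Longrightarrow> x (snd e) \<le> x (snd e')"
    using ex_has_least_nat[of "\<lambda>e. ?Q e \<and> ?ht e = ?ht e0" e0 "\<lambda>e. x (snd e)"] e0(1) by blast
  obtain p q where pq: "e = (p, q)" by (cases e)
  have *: "p \<in> P" "q \<in> P" "bad incE p q" using e(1) pq by auto
  have low: "max p q \<le> max u v" if "u \<in> P" "v \<in> P" "bad incE u v" for u v
    using e0(2)[of "(u, v)"] e(1) pq that by simp
  have left: "x q \<le> x v" if "u \<in> P" "v \<in> P" "bad incE u v" "max u v = max p q" for u v
    using e(2)[of "(u, v)"] e(1) pq that by simp
  have "clash_EF P (max u v)" if uv: "u \<in> P" "v \<in> P" "bad incE u v" and "x v < x q" for u v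
  proof -
    \<comment> \<open>At equal height, a right point further left than \<open>q\<close> would
      contradict the choice of \<open>(p, q)\<close>.\<close>
    have lt: "max p q < max u v"
      using left[OF uv] low[OF uv] that(4) by linarith
    have clash: ?thesis if "a \<in> P" "b \<in> P" "bad incF a b" "x v \<le> x a" "max a b \<le> max u v" for a b
      unfolding clash_EF_def using uv that
      by (intro bexI[of _ u] bexI[of _ v] bexI[of _ a] bexI[of _ b]) auto
    show ?thesis
    proof (cases incE)
      \<comment> \<open>Left pairs are ascents here, so heights are those of the right points:
        \<open>v\<close> is above \<open>q\<close> and to the left of it.\<close>
      case False
      then have "bad incF v q"
        using \<open>x v < x q\<close> lt uv(3) assms(1) *(3) by (auto simp: bad_def)
      then show ?thesis using clash[of v q] uv * lt by simp
    next
      case True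
      show ?thesis
      proof (cases "x v \<le> x p")
        case True
        then show ?thesis using clash[of p q] * \<open>incE\<close> assms(1) lt by simp
      next
        case False
        \<comment> \<open>Otherwise \<open>(p, v)\<close> is a descent of the same height
          \<open>p\<close> whose right point is further left than \<open>q\<close>.\<close>
        have "p \<le> v"
        proof (rule ccontr)
          assume "\<not> p \<le> v"
          then have "bad incE p v" "max p v = max p q"
            using False \<open>incE\<close> *(3) by (auto simp: bad_def)
          then show False using left[of p v] * uv \<open>x v < x q\<close> by auto
        qed
        then have "bad incF v q"
          using \<open>x v < x q\<close> assms(1) *(3) \<open>incE\<close> by (auto simp: bad_def)
        then show ?thesis using clash[of v q] uv * lt by simp
      qed
    qed
  qed
  then show ?thesis
    using that[OF *] low by (meson not_le)
qed

text \<open>Take the highest unblocked row \<open>h0\<close> with this clash and its top obstruction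
  \<open>S\<close>. The lowest left pair \<open>(p, q)\<close> is below every row concerned, and
  \<open>q\<close> is not to the right of \<open>v\<close>, as otherwise \<open>h0\<close> would be
  blocked. Hence \<open>(p, q)\<close> can replace each left pair, and \<open>S\<close> stays above
  all lower rows.\<close>

lemma clash_EB_cover:
  assumes "incF"
  shows "\<exists>T\<subseteq>P. card T \<le> 4 + 2 * N \<and> (\<forall>h. clash_EB P h \<longrightarrow> blocked_above h \<or> no_cut T h)"
proof (cases "\<exists>h. clash_EB P h \<and> \<not> blocked_above h")
  case False
  then show ?thesis by (intro exI[of _ "{}"]) auto
next
  case True
  let ?X = "{h. clash_EB P h \<and> \<not> blocked_above h}"
  have fin: "finite ?X"
    by (rule finite_clash_rows) (auto simp: clash_EB_def dest!: not_B_point)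
  define h0 where "h0 = Max ?X"
  have h0: "clash_EB P h0" "\<not> blocked_above h0"
    using Max_in[OF fin] True unfolding h0_def by auto
  obtain u v where *: "u \<in> P" "v \<in> P" "bad incE u v" "u \<le> h0" "v \<le> h0"
    "\<not> B {p \<in> P. x v \<le> x p \<and> h0 < p}"
    using h0(1) unfolding clash_EB_def by blast
  obtain p q where pq: "p \<in> P" "q \<in> P" "bad incE p q"
    "\<And>u v. u \<in> P \<Longrightarrow> v \<in> P \<Longrightarrow> bad incE u v \<Longrightarrow>
       max p q \<le> max u v \<and> (x q \<le> x v \<or> clash_EF P (max u v))"
    using lowest_bad_E_pair[OF assms *(1-3)] by metis
  have "\<not> clash_EF P (max u v)"
  proof
    assume "clash_EF P (max u v)"
    then have "clash_EF P h0"
      using *(4,5) unfolding clash_EF_def by (meson max.bounded_iff order_trans)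
    then show False using h0(2) clash_EF_blocked by blast
  qed
  then have xq: "x q \<le> x v" using pq(4)[OF *(1-3)] by blast
  obtain S where S: "S \<subseteq> {p \<in> P. x v \<le> x p \<and> h0 < p}" "finite S" "card S \<le> N" "\<not> B S"
    using B_small[OF *(6)] by blast
  let ?T = "{p, q} \<union> S"
  have "no_cut ?T h" if h: "clash_EB P h" "\<not> blocked_above h" for h
  proof -
    have "h \<le> h0" using Max_ge[OF fin] h unfolding h0_def by simp
    obtain u' v' where "u' \<in> P" "v' \<in> P" "bad incE u' v'" "u' \<le> h" "v' \<le> h"
      using h(1) unfolding clash_EB_def by blast
    then have le: "p \<le> h" "q \<le> h" using pq(4)[of u' v'] by auto
    have "\<not> B {r \<in> ?T. x q \<le> x r \<and> h < r}"
      by (rule not_B_mono[OF S(4)]) (use S(1) xq \<open>h \<le> h0\<close> in auto)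
    then have "clash_EB ?T h"
      unfolding clash_EB_def using le pq(3) by blast
    then show ?thesis by (rule clash_EB_no_cut)
  qed
  then show ?thesis
    using pq S(1) card_pair_Un[OF S(3)] by (intro exI[of _ ?T]) auto
qed

text \<open>As in \<open>clash_EB_cover\<close>, with the right pair replaced by one whose left
  point \<open>p\<close> is lowest. Right pairs are descents, so \<open>p\<close> is also the upper
  point and its height alone decides whether the pair is below a row.\<close>

lemma clash_AF_cover:
  assumes "\<not> incE" "incF"
  shows "\<exists>T\<subseteq>P. card T \<le> 4 + 2 * N \<and> (\<forall>h. clash_AF P h \<longrightarrow> blocked_above h \<or> no_cut T h)"
proof (cases "\<exists>h. clash_AF P h \<and> \<not> blocked_above h")
  case False
  then show ?thesis by (intro exI[of _ "{}"]) auto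
next
  case True
  let ?X = "{h. clash_AF P h \<and> \<not> blocked_above h}"
  have fin: "finite ?X"
    by (rule finite_clash_rows) (auto simp: clash_AF_def dest!: not_A_point)
  define h0 where "h0 = Max ?X"
  have h0: "clash_AF P h0" "\<not> blocked_above h0"
    using Max_in[OF fin] True unfolding h0_def by auto
  obtain u v where *: "u \<in> P" "v \<in> P" "bad incF u v" "u \<le> h0" "v \<le> h0"
    "\<not> A {p \<in> P. x p \<le> x u \<and> h0 < p}"
    using h0(1) unfolding clash_AF_def by blast
  let ?Q = "\<lambda>p. p \<in> P \<and> (\<exists>q\<in>P. bad incF p q)"
  obtain p where p: "?Q p" "\<And>p'. ?Q p' \<Longrightarrow> p \<le> p'"
    using ex_has_least_nat[of ?Q u "\<lambda>p. p"] * by blast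
  obtain q where q: "p \<in> P" "q \<in> P" "bad incF p q" using p(1) by blast
  \<comment> \<open>If \<open>p\<close> were left of \<open>u\<close>, it would also be lower, so
    \<open>(p, u)\<close> would be an ascent, forbidden on the left, and would clash with
    \<open>(u, v)\<close>.\<close>
  have xp: "x u \<le> x p"
  proof (rule ccontr)
    assume "\<not> x u \<le> x p"
    moreover have "p \<le> u" using p(2)[of u] * by blast
    ultimately have "bad incE p u" using assms(1) by (auto simp: bad_def le_less)
    then have "clash_EF P h0"
      unfolding clash_EF_def using * q \<open>p \<le> u\<close>
      by (intro bexI[of _ p] bexI[of _ u] bexI[of _ v]) auto
    then show False using h0(2) clash_EF_blocked by blast
  qed
  obtain S where S: "S \<subseteq> {p \<in> P. x p \<le> x u \<and> h0 < p}" "finite S" "card S \<le> N" "\<not> A S"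
    using A_small[OF *(6)] by blast
  let ?T = "{p, q} \<union> S"
  have "no_cut ?T h" if h: "clash_AF P h" "\<not> blocked_above h" for h
  proof -
    have "h \<le> h0" using Max_ge[OF fin] h unfolding h0_def by simp
    obtain u' v' where "u' \<in> P" "v' \<in> P" "bad incF u' v'" "u' \<le> h" "v' \<le> h"
      using h(1) unfolding clash_AF_def by blast
    then have "p \<le> h" using p(2)[of u'] by force
    then have le: "p \<le> h" "q \<le> h" using q(3) assms(2) by (auto simp: bad_def)
    have "\<not> A {r \<in> ?T. x r \<le> x p \<and> h < r}"
      by (rule not_A_mono[OF S(4)]) (use S(1) xp \<open>h \<le> h0\<close> in auto)
    then have "clash_AF ?T h"
      unfolding clash_AF_def using le q(3) by blast
    then show ?thesis by (rule clash_AF_no_cut)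
  qed
  then show ?thesis
    using q S(1) card_pair_Un[OF S(3)] by (intro exI[of _ ?T]) auto
qed

section \<open>A bounded obstruction to all pairs of lines\<close>

theorem bounded_obstruction:
  assumes "incE \<or> incF" and "\<And>h. no_cut P h"
  obtains T where "T \<subseteq> P" "card T \<le> 4 * (4 + 2 * N)" "\<And>h. no_cut T h"
proof -
  \<comment> \<open>Above all points the top cells are empty, so only two bottom pairs can clash;
    hence some row is blocked.\<close>
  obtain K where K: "\<And>p. p \<in> P \<Longrightarrow> p < K"
    using finite_nat_set_iff_bounded[of P] finite_P by auto
  have empty: "{p \<in> P. Q p \<and> K < p} = {}" for Q using K by (auto dest: less_asym)
  then have "\<not> clash_EB P K" "\<not> clash_AF P K" "\<not> clash_AB P K"
    unfolding clash_EB_def clash_AF_def clash_AB_def using A_empty B_empty by (simp_all only: empty) blast+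
  then have "blocked_above K"
    using no_cut_clash[OF assms(2)[of K]] clash_EF_blocked by blast
  \<comment> \<open>Rows from \<open>H\<close> on are handled by \<open>T1\<close>. Rows below
    \<open>H\<close> are not blocked, which leaves the covers \<open>T2\<close>, \<open>T3\<close>
    and \<open>T4\<close>.\<close>
  define H where "H = (LEAST h. blocked_above h)"
  have "blocked_above H" unfolding H_def using \<open>blocked_above K\<close> by (rule LeastI)
  then obtain T1 where T1: "T1 \<subseteq> P" "card T1 \<le> 4 + 2 * N" "\<And>h. H \<le> h \<Longrightarrow> no_cut T1 h"
    unfolding blocked_above_def by blast
  have below: "\<not> blocked_above h" if "h < H" for h
    using not_less_Least that unfolding H_def by blast
  obtain T2 where T2: "T2 \<subseteq> P" "card T2 \<le> 4 + 2 * N"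
    "\<And>h. clash_EB P h \<Longrightarrow> blocked_above h \<or> no_cut T2 h"
  proof (cases incF)
    case True
    then show ?thesis using clash_EB_cover that by blast
  next
    case False
    then show ?thesis using clash_EB_blocked that[of "{}"] by simp
  qed
  obtain T3 where T3: "T3 \<subseteq> P" "card T3 \<le> 4 + 2 * N"
    "\<And>h. clash_AF P h \<Longrightarrow> blocked_above h \<or> no_cut T3 h"
  proof (cases incE)
    case True
    then show ?thesis using clash_AF_blocked that[of "{}"] by simp
  next
    \<comment> \<open>With a decreasing left cell, \<open>incE \<or> incF\<close> makes the right
      cell increasing, as \<open>clash_AF_cover\<close> demands.\<close>
    case False
    then show ?thesis using clash_AF_cover assms(1) that by blast
  qed
  obtain T4 where T4: "T4 \<subseteq> P" "card T4 \<le> 4 + 2 * N" "\<And>h. clash_AB P h \<Longrightarrow> no_cut T4 h"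
    using clash_AB_cover by blast
  let ?T = "T1 \<union> T2 \<union> T3 \<union> T4"
  have "no_cut T1 h \<or> no_cut T2 h \<or> no_cut T3 h \<or> no_cut T4 h" for h
  proof (cases "H \<le> h")
    case True
    then show ?thesis using T1(3) by blast
  next
    case False
    then have nb: "\<not> blocked_above h" using below by simp
    then show ?thesis
      using no_cut_clash[OF assms(2)[of h]] clash_EF_blocked T2(3) T3(3) T4(3) by blast
  qed
  then have "no_cut ?T h" for h
    using no_cut_mono[of _ ?T h] by (meson Un_upper1 Un_upper2 order_trans)
  moreover have "card ?T \<le> 4 * (4 + 2 * N)"
    using card_Un_le[of "T1 \<union> T2 \<union> T3" T4] card_Un_le[of "T1 \<union> T2" T3] card_Un_le[of T1 T2]
      T1(2) T2(2) T3(2) T4(2) by simp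
  ultimately show ?thesis using that[of ?T] T1(1) T2(1) T3(1) T4(1) by blast
qed

end

section \<open>Standardization and containment\<close>

lemma perms_iff: "\<sigma> \<in> perms \<longleftrightarrow> distinct \<sigma> \<and> set \<sigma> = {1..length \<sigma>}"
proof
  assume "\<sigma> \<in> perms"
  then obtain n where n: "set \<sigma> = {1..n}" "distinct \<sigma>"
    unfolding perms_def by (auto dest: permutations_of_setD)
  then have "length \<sigma> = n" using distinct_card[of \<sigma>] by simp
  then show "distinct \<sigma> \<and> set \<sigma> = {1..length \<sigma>}" using n by simp
next
  assume "distinct \<sigma> \<and> set \<sigma> = {1..length \<sigma>}"
  then show "\<sigma> \<in> perms" unfolding perms_def by (auto intro!: permutations_of_setI)
qed

lemma perms_distinct: "\<sigma> \<in> perms \<Longrightarrow> distinct \<sigma>"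
  by (simp add: perms_iff)

lemma finite_perms_length_le: "finite {\<sigma> \<in> perms. length \<sigma> \<le> M}"
proof (rule finite_subset)
  show "{\<sigma> \<in> perms. length \<sigma> \<le> M} \<subseteq> (\<Union>n\<le>M. permutations_of_set {1..n})"
    by (auto simp: perms_iff intro!: permutations_of_setI)
qed simp

lemma order_isomorphic_sym: "order_isomorphic xs ys \<Longrightarrow> order_isomorphic ys xs"
  unfolding order_isomorphic_def by simp

lemma order_isomorphic_trans:
  "order_isomorphic xs ys \<Longrightarrow> order_isomorphic ys zs \<Longrightarrow> order_isomorphic xs zs"
  unfolding order_isomorphic_def by simp

lemma order_isomorphic_refl: "order_isomorphic xs xs"
  unfolding order_isomorphic_def by simp

lemma strict_mono_on_less_iff:
  fixes f :: "nat \<Rightarrow> nat"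
  assumes "strict_mono_on A f" "u \<in> A" "v \<in> A"
  shows "f u < f v \<longleftrightarrow> u < v"
  using assms by (metis less_asym linorder_neqE_nat strict_mono_onD)

lemma order_isomorphic_map:
  assumes "strict_mono_on (set xs) f"
  shows "order_isomorphic xs (map f xs)"
  using strict_mono_on_less_iff[OF assms] unfolding order_isomorphic_def by simp

text \<open>Supplies the columns of a plot. They count from 0, so that \<open>take k\<close> keeps
  exactly the columns below \<open>k\<close>; the value is meaningful only for entries of the
  list.\<close>

definition pos :: "nat list \<Rightarrow> nat \<Rightarrow> nat" where
  "pos xs = inv_into {..<length xs} ((!) xs)"

lemma pos_nth: "distinct xs \<Longrightarrow> i < length xs \<Longrightarrow> pos xs (xs ! i) = i"
  unfolding pos_def by (simp add: inj_on_nth inv_into_f_f)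

lemma
  assumes "v \<in> set xs"
  shows pos_less: "pos xs v < length xs" and nth_pos: "xs ! pos xs v = v"
proof -
  have *: "v \<in> (!) xs ` {..<length xs}" using assms by (auto simp: in_set_conv_nth)
  show "pos xs v < length xs" using inv_into_into[OF *] unfolding pos_def by simp
  show "xs ! pos xs v = v" using f_inv_into_f[OF *] unfolding pos_def by simp
qed

lemma inj_on_pos: "inj_on (pos xs) (set xs)"
  by (metis inj_onI nth_pos)

text \<open>Replaces comparison by indices with a monotone relabelling of values, which passes
  easily through sublists and cells.\<close>

lemma order_isomorphic_distinctE:
  assumes "distinct xs" "order_isomorphic xs ys"
  obtains f where "strict_mono_on (set xs) f" "ys = map f xs"
proof -
  let ?f = "\<lambda>v. ys ! pos xs v"
  have len: "length ys = length xs" using assms(2) unfolding order_isomorphic_def by simp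
  have "strict_mono_on (set xs) ?f"
    using assms(2) unfolding order_isomorphic_def
    by (intro strict_mono_onI) (metis nth_pos pos_less)
  moreover have "ys = map ?f xs"
    by (rule nth_equalityI) (simp_all add: len pos_nth assms(1))
  ultimately show ?thesis using that by blast
qed

text \<open>In a permutation each value \<open>v\<close> is the number of entries that are at most
  \<open>v\<close>, and a strictly monotone relabelling preserves this number.\<close>

lemma order_isomorphic_perms_eq:
  assumes "\<sigma> \<in> perms" "\<tau> \<in> perms" "order_isomorphic \<sigma> \<tau>"
  shows "\<sigma> = \<tau>"
proof -
  obtain f where f: "strict_mono_on (set \<sigma>) f" "\<tau> = map f \<sigma>"
    using order_isomorphic_distinctE[OF perms_distinct[OF assms(1)] assms(3)] by blast
  have val: "card {w \<in> set \<rho>. w \<le> v} = v" if "\<rho> \<in> perms" "v \<in> set \<rho>" for \<rho> v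
  proof -
    have "{w \<in> set \<rho>. w \<le> v} = {1..v}" using that by (auto simp: perms_iff)
    then show ?thesis by simp
  qed
  have "f v = v" if "v \<in> set \<sigma>" for v
  proof -
    have "{w \<in> set \<tau>. w \<le> f v} = f ` {w \<in> set \<sigma>. w \<le> v}"
      using strict_mono_on_less_iff[OF f(1)] that f(2) by (auto simp flip: not_less)
    moreover have "inj_on f {w \<in> set \<sigma>. w \<le> v}"
      using strict_mono_on_imp_inj_on[OF f(1)] by (rule inj_on_subset) auto
    ultimately have "card {w \<in> set \<tau>. w \<le> f v} = card {w \<in> set \<sigma>. w \<le> v}"
      by (simp add: card_image)
    then show ?thesis using val[OF assms(1) that] val[OF assms(2), of "f v"] that f(2) by simp
  qed
  then show ?thesis using f(2) by (simp add: map_idI)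
qed

lemma ex_standardization:
  assumes "distinct xs"
  obtains \<sigma> where "\<sigma> \<in> perms" "order_isomorphic xs \<sigma>"
proof -
  \<comment> \<open>The rank of \<open>v\<close> among the entries.\<close>
  define f where "f v = card {w \<in> set xs. w \<le> v}" for v
  have mono: "strict_mono_on (set xs) f"
    unfolding f_def by (intro strict_mono_onI psubset_card_mono psubsetI) force+
  then have inj: "inj_on f (set xs)" by (rule strict_mono_on_imp_inj_on)
  have "f ` set xs = {1..length xs}"
  proof (rule card_subset_eq)
    show "f ` set xs \<subseteq> {1..length xs}"
    proof safe
      fix v assume "v \<in> set xs"
      then have "{v} \<subseteq> {w \<in> set xs. w \<le> v}" by auto
      from card_mono[OF _ this] have "1 \<le> f v" unfolding f_def by simp
      moreover have "f v \<le> card (set xs)" unfolding f_def by (intro card_mono) auto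
      ultimately show "f v \<in> {1..length xs}" using distinct_card[OF assms] by simp
    qed
    show "card (f ` set xs) = card {1..length xs}"
      using card_image[OF inj] distinct_card[OF assms] by simp
  qed simp
  then have "map f xs \<in> perms"
    using assms inj by (simp add: perms_iff distinct_map)
  then show ?thesis using that order_isomorphic_map[OF mono] by blast
qed

section \<open>Subsequences of lists with distinct entries\<close>

lemma subseq_set_subset: "subseq xs ys \<Longrightarrow> set xs \<subseteq> set ys"
  by (metis notin_set_nthsI subseq_conv_nths subsetI)

lemma subseq_order_isomorphic:
  assumes "distinct xs" "order_isomorphic xs ys" "subseq zs xs"
  obtains ws where "subseq ws ys" "order_isomorphic zs ws"
proof -
  obtain f where f: "strict_mono_on (set xs) f" "ys = map f xs"
    using order_isomorphic_distinctE[OF assms(1,2)] by blast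
  have "set zs \<subseteq> set xs" using subseq_set_subset[OF assms(3)] .
  then have "strict_mono_on (set zs) f" using f(1) monotone_on_subset by blast
  then show ?thesis
    using that[of "map f zs"] order_isomorphic_map subseq_map[OF assms(3)] f(2) by blast
qed

lemma subseq_distinct: "subseq xs ys \<Longrightarrow> distinct ys \<Longrightarrow> distinct xs"
  by (auto simp: subseq_conv_nths intro: distinct_nthsI)

text \<open>Identifies subsequences of a permutation with sets of points, the form in which
  obstructions are counted.\<close>

lemma subseq_eq_filter:
  "subseq xs ys \<Longrightarrow> distinct ys \<Longrightarrow> xs = filter (\<lambda>v. v \<in> set xs) ys"
proof (induction rule: list_emb.induct)
  case (list_emb_Cons xs ys y)
  have "y \<notin> set xs"
    using subseq_set_subset[OF list_emb_Cons(1)] list_emb_Cons.prems by auto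
  then have "filter (\<lambda>v. v \<in> set xs) (y # ys) = filter (\<lambda>v. v \<in> set xs) ys" by simp
  then show ?case using list_emb_Cons.IH list_emb_Cons.prems by (metis distinct.simps(2))
next
  case (list_emb_Cons2 x y xs ys)
  have "filter (\<lambda>v. v \<in> set (x # xs)) ys = filter (\<lambda>v. v \<in> set xs) ys"
    using list_emb_Cons2 by (intro filter_cong) auto
  then have "filter (\<lambda>v. v \<in> set (x # xs)) (y # ys) = x # filter (\<lambda>v. v \<in> set xs) ys"
    using list_emb_Cons2.hyps by simp
  then show ?case using list_emb_Cons2.IH list_emb_Cons2.prems by (metis distinct.simps(2))
qed simp

lemma contained_in_iso:
  assumes "distinct xs" "order_isomorphic xs ys" "contained_in \<sigma> xs"
  shows "contained_in \<sigma> ys"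
proof -
  obtain zs where zs: "subseq zs xs" "order_isomorphic zs \<sigma>"
    using assms(3) unfolding contained_in_def by blast
  obtain ws where "subseq ws ys" "order_isomorphic zs ws"
    using subseq_order_isomorphic[OF assms(1,2) zs(1)] .
  then show ?thesis
    unfolding contained_in_def using zs(2) order_isomorphic_sym order_isomorphic_trans by blast
qed

lemma contained_in_trans:
  assumes "\<tau> \<in> perms" "contained_in \<sigma> \<tau>" "contained_in \<tau> \<pi>"
  shows "contained_in \<sigma> \<pi>"
proof -
  obtain ys where ys: "subseq ys \<pi>" "order_isomorphic ys \<tau>"
    using assms(3) unfolding contained_in_def by blast
  have "contained_in \<sigma> ys"
    using contained_in_iso[OF perms_distinct[OF assms(1)] order_isomorphic_sym[OF ys(2)] assms(2)] .
  then show ?thesis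
    unfolding contained_in_def using ys(1) subseq_order.order_trans by blast
qed

lemma perm_class_Av:
  assumes "[] \<notin> B"
  shows "perm_class (Av B)"
proof -
  have "\<not> contained_in \<beta> []" if "\<beta> \<in> B" for \<beta>
    using that assms unfolding contained_in_def order_isomorphic_def
    by (metis length_0_conv list_emb_Nil2)
  moreover have "[] \<in> perms" by (simp add: perms_iff)
  ultimately show ?thesis
    unfolding perm_class_def Av_def using contained_in_trans by blast
qed

section \<open>Membership of cells in classes, and finite bases\<close>

lemma forms_perm_in_iso:
  "order_isomorphic xs ys \<Longrightarrow> forms_perm_in xs \<C> \<longleftrightarrow> forms_perm_in ys \<C>"
  unfolding forms_perm_in_def using order_isomorphic_sym order_isomorphic_trans by blast

lemma forms_perm_in_perms:
  "\<C> \<subseteq> perms \<Longrightarrow> \<sigma> \<in> perms \<Longrightarrow> forms_perm_in \<sigma> \<C> \<longleftrightarrow> \<sigma> \<in> \<C>"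
  unfolding forms_perm_in_def using order_isomorphic_perms_eq order_isomorphic_refl by blast

lemma forms_perm_in_Nil: "perm_class \<C> \<Longrightarrow> forms_perm_in [] \<C>"
  unfolding forms_perm_in_def perm_class_def using order_isomorphic_refl by blast

lemma forms_perm_in_subseq:
  assumes "perm_class \<C>" "distinct xs" "subseq ys xs" "forms_perm_in xs \<C>"
  shows "forms_perm_in ys \<C>"
proof -
  obtain \<sigma> where \<sigma>: "\<sigma> \<in> \<C>" "order_isomorphic xs \<sigma>"
    using assms(4) unfolding forms_perm_in_def by blast
  obtain ws where ws: "subseq ws \<sigma>" "order_isomorphic ys ws"
    using subseq_order_isomorphic[OF assms(2) \<sigma>(2) assms(3)] .
  obtain \<tau> where \<tau>: "\<tau> \<in> perms" "order_isomorphic ys \<tau>"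
    using ex_standardization[OF subseq_distinct[OF assms(3,2)]] .
  have "contained_in \<tau> \<sigma>"
    unfolding contained_in_def
    using ws \<tau>(2) order_isomorphic_sym order_isomorphic_trans by blast
  then have "\<tau> \<in> \<C>" using assms(1) \<sigma>(1) \<tau>(1) unfolding perm_class_def by blast
  then show ?thesis using \<tau>(2) unfolding forms_perm_in_def by blast
qed

text \<open>A shortest subsequence that forms no member of the class standardizes to a basis
  element, so the maximal length in the basis is a bound. If the basis is empty, \<open>Max\<close>
  is unspecified, but then no such \<open>xs\<close> exists.\<close>

lemma finitely_based_bound:
  assumes "finitely_based_class \<C>"
  obtains N where "\<And>xs. distinct xs \<Longrightarrow> \<not> forms_perm_in xs \<C> \<Longrightarrow>
    \<exists>ys. subseq ys xs \<and> length ys \<le> N \<and> \<not> forms_perm_in ys \<C>"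
proof -
  have cl: "perm_class \<C>" "\<C> \<subseteq> perms" and fin: "finite (basis \<C>)"
    using assms unfolding finitely_based_class_def perm_class_def by auto
  have "\<exists>ys. subseq ys xs \<and> length ys \<le> Max (length ` basis \<C>) \<and> \<not> forms_perm_in ys \<C>"
    if xs: "distinct xs" "\<not> forms_perm_in xs \<C>" for xs
  proof -
    obtain ys where ys: "subseq ys xs" "\<not> forms_perm_in ys \<C>"
      "\<And>zs. subseq zs xs \<Longrightarrow> \<not> forms_perm_in zs \<C> \<Longrightarrow> length ys \<le> length zs"
      using ex_has_least_nat[of "\<lambda>ys. subseq ys xs \<and> \<not> forms_perm_in ys \<C>" xs length] xs(2)
      by blast
    have dys: "distinct ys" using subseq_distinct[OF ys(1) xs(1)] .
    obtain \<beta> where \<beta>: "\<beta> \<in> perms" "order_isomorphic ys \<beta>"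
      using ex_standardization[OF dys] .
    have "\<beta> \<in> basis \<C>"
      unfolding basis_def
    proof (intro CollectI conjI ballI impI)
      show "\<beta> \<in> perms - \<C>"
        using \<beta> ys(2) unfolding forms_perm_in_def by blast
      fix \<sigma> assume \<sigma>: "\<sigma> \<in> perms - \<C>" "contained_in \<sigma> \<beta>"
      obtain zs where zs: "subseq zs \<beta>" "order_isomorphic zs \<sigma>"
        using \<sigma>(2) unfolding contained_in_def by blast
      obtain ws where ws: "subseq ws ys" "order_isomorphic zs ws"
        using subseq_order_isomorphic[OF perms_distinct[OF \<beta>(1)] order_isomorphic_sym[OF \<beta>(2)] zs(1)] .
      have "order_isomorphic ws \<sigma>"
        using ws(2) zs(2) order_isomorphic_sym order_isomorphic_trans by blast
      then have "\<not> forms_perm_in ws \<C>"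
        using forms_perm_in_iso forms_perm_in_perms[OF cl(2)] \<sigma>(1) by blast
      \<comment> \<open>A smaller nonmember inside \<open>\<beta>\<close> would come from a shorter
        subsequence of \<open>ys\<close>; minimality forces it to be all of
        \<open>ys\<close>.\<close>
      then have "length ys \<le> length ws"
        using ys(1,3) ws(1) subseq_order.order_trans by blast
      then have "ws = ys"
        using ws(1) list_emb_length[OF ws(1)] by (simp add: subseq_same_length)
      then show "\<sigma> = \<beta>"
        using \<open>order_isomorphic ws \<sigma>\<close> \<beta> \<sigma>(1) order_isomorphic_perms_eq
          order_isomorphic_sym order_isomorphic_trans by blast
    qed
    then have "length \<beta> \<le> Max (length ` basis \<C>)" using fin by simp
    moreover have "length \<beta> = length ys" using \<beta>(2) unfolding order_isomorphic_def by simp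
    ultimately show ?thesis using ys by auto
  qed
  then show ?thesis using that by blast
qed

text \<open>A basis element equals every nonmember contained in it, so its own length is at most
  \<open>M\<close>.\<close>

lemma finite_basisI:
  assumes "\<And>\<pi>. \<pi> \<in> perms - \<C> \<Longrightarrow> \<exists>\<sigma>\<in>perms - \<C>. contained_in \<sigma> \<pi> \<and> length \<sigma> \<le> M"
  shows "finite (basis \<C>)"
proof (rule finite_subset[OF _ finite_perms_length_le])
  show "basis \<C> \<subseteq> {\<sigma> \<in> perms. length \<sigma> \<le> M}"
    using assms unfolding basis_def by blast
qed

section \<open>Grid classes\<close>

text \<open>The condition of \<open>Grid\<close> without \<open>perms\<close>, so that subsequences
  can be tested before standardization.\<close>

definition griddable ::
  "nat list set \<Rightarrow> nat list set \<Rightarrow> nat list set \<Rightarrow> nat list set \<Rightarrow> nat list \<Rightarrow> bool" where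
  "griddable \<A> \<B> \<E> \<F> xs \<longleftrightarrow> (\<exists>k h.
     forms_perm_in (filter (\<lambda>y. h < y) (take k xs)) \<A> \<and>
     forms_perm_in (filter (\<lambda>y. h < y) (drop k xs)) \<B> \<and>
     forms_perm_in (filter (\<lambda>y. y \<le> h) (take k xs)) \<E> \<and>
     forms_perm_in (filter (\<lambda>y. y \<le> h) (drop k xs)) \<F>)"

lemma Grid_iff: "\<pi> \<in> Grid \<A> \<B> \<E> \<F> \<longleftrightarrow> \<pi> \<in> perms \<and> griddable \<A> \<B> \<E> \<F> \<pi>"
  unfolding Grid_def griddable_def by simp

lemma griddable_iso:
  assumes "distinct xs" "order_isomorphic xs ys" "0 \<notin> set ys" "griddable \<A> \<B> \<E> \<F> xs"
  shows "griddable \<A> \<B> \<E> \<F> ys"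
proof -
  obtain f where f: "strict_mono_on (set xs) f" "ys = map f xs"
    using order_isomorphic_distinctE[OF assms(1,2)] by blast
  obtain k h where g: "forms_perm_in (filter (\<lambda>y. h < y) (take k xs)) \<A>"
    "forms_perm_in (filter (\<lambda>y. h < y) (drop k xs)) \<B>"
    "forms_perm_in (filter (\<lambda>y. y \<le> h) (take k xs)) \<E>"
    "forms_perm_in (filter (\<lambda>y. y \<le> h) (drop k xs)) \<F>"
    using assms(4) unfolding griddable_def by blast
  \<comment> \<open>The image of the highest entry not above \<open>h\<close>, or 0 if there is
    none; \<open>0 \<notin> set ys\<close> ensures that 0 is then below all of
    \<open>ys\<close>.\<close>
  define h' where "h' = Max (insert 0 (f ` {v \<in> set xs. v \<le> h}))"
  have h': "h' < f v \<longleftrightarrow> h < v" if "v \<in> set xs" for v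
  proof -
    have "h' < f v \<longleftrightarrow> 0 < f v \<and> (\<forall>w\<in>set xs. w \<le> h \<longrightarrow> f w < f v)"
      unfolding h'_def by auto
    also have "\<dots> \<longleftrightarrow> (\<forall>w\<in>set xs. w \<le> h \<longrightarrow> w < v)"
      using strict_mono_on_less_iff[OF f(1)] that assms(3) f(2) by (metis gr0I image_eqI set_map)
    also have "\<dots> \<longleftrightarrow> h < v"
      using that by (meson leI le_less_trans less_irrefl)
    finally show ?thesis .
  qed
  have up: "filter (\<lambda>y. h' < y) (map f zs) = map f (filter (\<lambda>y. h < y) zs)"
    and down: "filter (\<lambda>y. y \<le> h') (map f zs) = map f (filter (\<lambda>y. y \<le> h) zs)"
    if "set zs \<subseteq> set xs" for zs
    using h' that by (auto simp: filter_map o_def not_less[symmetric] intro!: arg_cong[of _ _ "map f"] filter_cong)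
  have iso: "forms_perm_in (map f zs) \<C> \<longleftrightarrow> forms_perm_in zs \<C>" if "set zs \<subseteq> set xs" for zs \<C>
    using forms_perm_in_iso order_isomorphic_map monotone_on_subset[OF f(1) that] by blast
  have sub: "set (filter Q (take k xs)) \<subseteq> set xs" "set (filter Q (drop k xs)) \<subseteq> set xs" for Q
    using set_take_subset set_drop_subset by fastforce+
  show ?thesis
    unfolding griddable_def f(2) take_map drop_map
    by (intro exI[of _ k] exI[of _ h'])
      (simp only: up down set_take_subset set_drop_subset iso sub g simp_thms)
qed

text \<open>Deleting points yields no new vertical cuts, so a subsequence can be gridded in the
  columns of the whole permutation.\<close>

lemma ex_cut_filter:
  "(\<exists>k. \<Phi> (take k (filter Q xs)) (drop k (filter Q xs))) \<longleftrightarrow>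
   (\<exists>k. \<Phi> (filter Q (take k xs)) (filter Q (drop k xs)))"
proof
  have "\<exists>j. filter Q (take j xs) = take k (filter Q xs) \<and> filter Q (drop j xs) = drop k (filter Q xs)" for k
  proof (induction xs arbitrary: k)
    case (Cons a xs)
    show ?case
    proof (cases "k = 0")
      case True
      then show ?thesis by (intro exI[of _ 0]) simp
    next
      case False
      \<comment> \<open>A head rejected by \<open>Q\<close> is passed over without using up any of
        \<open>k\<close>.\<close>
      obtain j where "filter Q (take j xs) = take (if Q a then k - 1 else k) (filter Q xs) \<and>
        filter Q (drop j xs) = drop (if Q a then k - 1 else k) (filter Q xs)"
        using Cons.IH by blast
      then show ?thesis using False by (intro exI[of _ "Suc j"]) (auto simp: take_Cons' drop_Cons')
    qed
  qed simp
  then show "\<exists>k. \<Phi> (take k (filter Q xs)) (drop k (filter Q xs)) \<Longrightarrow>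
    \<exists>k. \<Phi> (filter Q (take k xs)) (filter Q (drop k xs))" by metis
  show "\<exists>k. \<Phi> (filter Q (take k xs)) (filter Q (drop k xs)) \<Longrightarrow>
    \<exists>k. \<Phi> (take k (filter Q xs)) (drop k (filter Q xs))"
    by (metis append_take_drop_id filter_append append_eq_conv_conj)
qed

lemma griddable_filter_iff:
  "griddable \<A> \<B> \<E> \<F> (filter Q xs) \<longleftrightarrow> (\<exists>k h.
     forms_perm_in (filter (\<lambda>y. Q y \<and> h < y) (take k xs)) \<A> \<and>
     forms_perm_in (filter (\<lambda>y. Q y \<and> h < y) (drop k xs)) \<B> \<and>
     forms_perm_in (filter (\<lambda>y. Q y \<and> y \<le> h) (take k xs)) \<E> \<and>
     forms_perm_in (filter (\<lambda>y. Q y \<and> y \<le> h) (drop k xs)) \<F>)"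
  unfolding griddable_def
  using ex_cut_filter[of "\<lambda>us vs. \<exists>h. forms_perm_in (filter (\<lambda>y. h < y) us) \<A> \<and>
     forms_perm_in (filter (\<lambda>y. h < y) vs) \<B> \<and>
     forms_perm_in (filter (\<lambda>y. y \<le> h) us) \<E> \<and>
     forms_perm_in (filter (\<lambda>y. y \<le> h) vs) \<F>" Q xs]
  by simp

lemma perm_class_Grid:
  assumes cl: "perm_class \<A>" "perm_class \<B>" "perm_class \<E>" "perm_class \<F>"
  shows "perm_class (Grid \<A> \<B> \<E> \<F>)"
proof -
  have "[] \<in> Grid \<A> \<B> \<E> \<F>"
    using cl by (simp add: Grid_iff griddable_def forms_perm_in_Nil perms_iff)
  moreover have "\<sigma> \<in> Grid \<A> \<B> \<E> \<F>"
    if \<pi>: "\<pi> \<in> Grid \<A> \<B> \<E> \<F>" and \<sigma>: "\<sigma> \<in> perms" "contained_in \<sigma> \<pi>" for \<pi> \<sigma>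
  proof -
    have d: "distinct \<pi>" and "griddable \<A> \<B> \<E> \<F> \<pi>"
      using \<pi> by (simp_all add: Grid_iff perms_distinct)
    then obtain k h where g: "forms_perm_in (filter (\<lambda>y. h < y) (take k \<pi>)) \<A>"
      "forms_perm_in (filter (\<lambda>y. h < y) (drop k \<pi>)) \<B>"
      "forms_perm_in (filter (\<lambda>y. y \<le> h) (take k \<pi>)) \<E>"
      "forms_perm_in (filter (\<lambda>y. y \<le> h) (drop k \<pi>)) \<F>"
      unfolding griddable_def by blast
    obtain zs where zs: "subseq zs \<pi>" "order_isomorphic zs \<sigma>"
      using \<sigma>(2) unfolding contained_in_def by blast
    have restrict: "forms_perm_in (filter (\<lambda>y. y \<in> set zs \<and> R y) ws) \<X>"
      if "perm_class \<X>" "distinct ws" "forms_perm_in (filter R ws) \<X>" for R ws \<X>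
      using forms_perm_in_subseq[OF that(1) _ subseq_filter_left that(3), of "\<lambda>y. y \<in> set zs"] that(2)
      by (simp add: conj_commute)
    \<comment> \<open>The lines \<open>k\<close> and \<open>h\<close> of \<open>\<pi>\<close> also
      grid the subsequence, each cell only losing points.\<close>
    have "griddable \<A> \<B> \<E> \<F> (filter (\<lambda>y. y \<in> set zs) \<pi>)"
      unfolding griddable_filter_iff
      using g d cl by (intro exI[of _ k] exI[of _ h] conjI restrict) auto
    then have "griddable \<A> \<B> \<E> \<F> zs"
      using subseq_eq_filter[OF zs(1) d] by simp
    moreover have "0 \<notin> set \<sigma>" using \<sigma>(1) by (simp add: perms_iff)
    ultimately show ?thesis
      using griddable_iso[OF subseq_distinct[OF zs(1) d] zs(2)] \<sigma>(1) by (simp add: Grid_iff)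
  qed
  moreover have "Grid \<A> \<B> \<E> \<F> \<subseteq> perms"
    unfolding Grid_def by blast
  ultimately show ?thesis
    unfolding perm_class_def by blast
qed

section \<open>Monotone cells as cells without a forbidden pair\<close>

lemma subseq_pair_filter:
  "subseq [u, v] (filter Q xs) \<longleftrightarrow> Q u \<and> Q v \<and> subseq [u, v] xs"
proof
  assume *: "subseq [u, v] (filter Q xs)"
  have "Q u" "Q v"
    using subseq_set_subset[OF *] by simp_all
  then show "Q u \<and> Q v \<and> subseq [u, v] xs"
    using subseq_order.order_trans[OF * subseq_filter_left] by blast
next
  assume "Q u \<and> Q v \<and> subseq [u, v] xs"
  then show "subseq [u, v] (filter Q xs)"
    using subseq_filter[of "[u, v]" xs Q] by simp
qed

lemma subseq_pair_iff_nth: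
  "subseq [u, v] xs \<longleftrightarrow> (\<exists>j<length xs. \<exists>i<j. xs ! i = u \<and> xs ! j = v)"
proof -
  \<comment> \<open>\<open>sorted_wrt\<close> recurses over the list like \<open>subseq\<close> and
    also has a characterization by pairs of indices.\<close>
  have "subseq [u, v] xs \<longleftrightarrow> \<not> sorted_wrt (\<lambda>a b. \<not> (a = u \<and> b = v)) xs"
  proof (induction xs)
    case (Cons a xs)
    have "v \<in> set xs" if "subseq [u, v] xs"
      using subseq_set_subset[OF that] by simp
    then show ?case using Cons by (cases "u = a") (auto simp: subseq_singleton_left)
  qed simp
  then show ?thesis by (auto simp: sorted_wrt_iff_nth_less)
qed

lemma subseq_pair_iff_pos:
  assumes "distinct xs"
  shows "subseq [u, v] xs \<longleftrightarrow> u \<in> set xs \<and> v \<in> set xs \<and> pos xs u < pos xs v"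
proof -
  have "subseq [u, v] xs \<Longrightarrow> u \<in> set xs \<and> v \<in> set xs \<and> pos xs u < pos xs v"
    unfolding subseq_pair_iff_nth using pos_nth[OF assms] by fastforce
  moreover have "u \<in> set xs \<and> v \<in> set xs \<and> pos xs u < pos xs v \<Longrightarrow> subseq [u, v] xs"
    unfolding subseq_pair_iff_nth using nth_pos pos_less by metis
  ultimately show ?thesis by blast
qed

lemma forms_perm_in_Av:
  assumes "distinct xs"
  shows "forms_perm_in xs (Av {\<beta>}) \<longleftrightarrow> \<not> (\<exists>ys. subseq ys xs \<and> order_isomorphic ys \<beta>)"
proof -
  obtain \<sigma> where \<sigma>: "\<sigma> \<in> perms" "order_isomorphic xs \<sigma>"
    using ex_standardization[OF assms] .
  have "forms_perm_in xs (Av {\<beta>}) \<longleftrightarrow> \<sigma> \<in> Av {\<beta>}"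
    using forms_perm_in_iso[OF \<sigma>(2)] forms_perm_in_perms[OF _ \<sigma>(1), of "Av {\<beta>}"]
    by (simp add: Av_def)
  also have "\<dots> \<longleftrightarrow> \<not> contained_in \<beta> \<sigma>" using \<sigma>(1) unfolding Av_def by simp
  also have "contained_in \<beta> \<sigma> \<longleftrightarrow> (\<exists>ys. subseq ys xs \<and> order_isomorphic ys \<beta>)"
    using contained_in_iso[OF perms_distinct[OF \<sigma>(1)] order_isomorphic_sym[OF \<sigma>(2)], of \<beta>]
      contained_in_iso[OF assms \<sigma>(2), of \<beta>] contained_in_def[of \<beta> xs] by argo
  finally show ?thesis .
qed

definition forbidden_pair :: "bool \<Rightarrow> nat list" where
  "forbidden_pair inc = (if inc then [2, 1] else [1, 2])"

lemma order_isomorphic_forbidden_pair: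
  "order_isomorphic xs (forbidden_pair inc) \<longleftrightarrow>
     (\<exists>u v. xs = [u, v] \<and> (if inc then v < u else u < v))"
proof -
  have "length xs = 2 \<longleftrightarrow> (\<exists>u v. xs = [u, v])"
    by (auto simp: length_Suc_conv numeral_2_eq_2)
  then show ?thesis
    unfolding order_isomorphic_def forbidden_pair_def
    by (auto simp: less_Suc_eq)
qed

text \<open>Writes a cell as a set of points selected by value and column, which is the shape of the
  cells in \<open>plot_gridding\<close>.\<close>

lemma take_eq_filter_pos:
  assumes "distinct xs"
  shows "filter Q (take k xs) = filter (\<lambda>v. Q v \<and> pos xs v < k) xs"
    and "filter Q (drop k xs) = filter (\<lambda>v. Q v \<and> k \<le> pos xs v) xs"
proof -
  have 1: "pos xs v < k" if v: "v \<in> set (take k xs)" for v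
    using v pos_nth[OF assms] by (auto simp: in_set_conv_nth)
  have 2: "k \<le> pos xs v" if v: "v \<in> set (drop k xs)" for v
    using v pos_nth[OF assms] by (auto simp: in_set_conv_nth)
  have "filter (\<lambda>v. Q v \<and> pos xs v < k) (take k xs @ drop k xs) = filter Q (take k xs)"
    using 1 2 by (auto simp: filter_empty_conv not_less simp del: append_take_drop_id intro!: filter_cong)
  then show "filter Q (take k xs) = filter (\<lambda>v. Q v \<and> pos xs v < k) xs" by simp
  have "filter (\<lambda>v. Q v \<and> k \<le> pos xs v) (take k xs @ drop k xs) = filter Q (drop k xs)"
    using 1 2 by (auto simp: filter_empty_conv not_le simp del: append_take_drop_id intro!: filter_cong)
  then show "filter Q (drop k xs) = filter (\<lambda>v. Q v \<and> k \<le> pos xs v) xs" by simp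
qed

section \<open>Finite bases of the grid classes\<close>

text \<open>For \<open>\<pi>\<close> outside the class, \<open>bounded_obstruction\<close> on its
  plot gives boundedly many points that already admit no gridding. Their standardization is a short
  nonmember contained in \<open>\<pi>\<close>, as \<open>finite_basisI\<close> requires.\<close>

lemma finitely_based_Grid_mono:
  assumes fb: "finitely_based_class \<C>" "finitely_based_class \<D>" and inc: "incE \<or> incF"
  shows "finitely_based_class (Grid \<C> \<D> (Av {forbidden_pair incE}) (Av {forbidden_pair incF}))"
    (is "finitely_based_class ?G")
proof -
  let ?grd = "griddable \<C> \<D> (Av {forbidden_pair incE}) (Av {forbidden_pair incF})"
  have cl: "perm_class \<C>" "perm_class \<D>"
    using fb unfolding finitely_based_class_def by auto
  obtain NC where NC: "\<And>xs. distinct xs \<Longrightarrow> \<not> forms_perm_in xs \<C> \<Longrightarrow>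
    \<exists>ys. subseq ys xs \<and> length ys \<le> NC \<and> \<not> forms_perm_in ys \<C>"
    using finitely_based_bound[OF fb(1)] by blast
  obtain ND where ND: "\<And>xs. distinct xs \<Longrightarrow> \<not> forms_perm_in xs \<D> \<Longrightarrow>
    \<exists>ys. subseq ys xs \<and> length ys \<le> ND \<and> \<not> forms_perm_in ys \<D>"
    using finitely_based_bound[OF fb(2)] by blast
  define N where "N = max NC ND"
  have "\<exists>\<sigma>\<in>perms - ?G. contained_in \<sigma> \<pi> \<and> length \<sigma> \<le> 4 * (4 + 2 * N)"
    if \<pi>: "\<pi> \<in> perms - ?G" for \<pi>
  proof -
    have d: "distinct \<pi>" and pos_vals: "0 \<notin> set \<pi>" and not_grd: "\<not> ?grd \<pi>"
      using \<pi> by (simp_all add: Grid_iff perms_iff)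
    \<comment> \<open>The predicates \<open>A\<close> and \<open>B\<close> of the locale: the points
      of \<open>\<pi>\<close> in \<open>T\<close>, read from left to right, form a member of the
      class.\<close>
    define \<phi> where "\<phi> \<X> T = forms_perm_in (filter (\<lambda>v. v \<in> T) \<pi>) \<X>" for \<X> T
    have \<phi>_mono: "\<phi> \<X> S" if "perm_class \<X>" "S \<subseteq> T" "\<phi> \<X> T" for \<X> S T
    proof -
      have "filter (\<lambda>v. v \<in> S) \<pi> = filter (\<lambda>v. v \<in> S) (filter (\<lambda>v. v \<in> T) \<pi>)"
        using that(2) by (auto intro!: filter_cong)
      then show ?thesis
        using forms_perm_in_subseq[OF that(1) _ _ that(3)[unfolded \<phi>_def]] d
        unfolding \<phi>_def by (metis distinct_filter subseq_filter_left)
    qed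
    have \<phi>_small: "\<exists>S\<subseteq>T. finite S \<and> card S \<le> N \<and> \<not> \<phi> \<X> S"
      if bound: "\<And>xs. distinct xs \<Longrightarrow> \<not> forms_perm_in xs \<X> \<Longrightarrow>
          \<exists>ys. subseq ys xs \<and> length ys \<le> N' \<and> \<not> forms_perm_in ys \<X>"
        and "N' \<le> N" and T: "\<not> \<phi> \<X> T" for \<X> N' T
    proof -
      obtain ys where ys: "subseq ys (filter (\<lambda>v. v \<in> T) \<pi>)" "length ys \<le> N'" "\<not> forms_perm_in ys \<X>"
        using bound T d unfolding \<phi>_def by (meson distinct_filter)
      have "ys = filter (\<lambda>v. v \<in> set ys) \<pi>"
        using subseq_eq_filter[OF subseq_order.order_trans[OF ys(1) subseq_filter_left] d] .
      then have "\<not> \<phi> \<X> (set ys)" using ys(3) unfolding \<phi>_def by simp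
      moreover have "set ys \<subseteq> T" using subseq_set_subset[OF ys(1)] by auto
      moreover have "card (set ys) \<le> N" using card_length[of ys] ys(2) \<open>N' \<le> N\<close> by linarith
      ultimately show ?thesis by blast
    qed
    interpret plot_gridding "set \<pi>" "pos \<pi>" "\<phi> \<C>" "\<phi> \<D>" incE incF N
    proof
      show "inj_on (pos \<pi>) (set \<pi>)" by (rule inj_on_pos)
      show "\<phi> \<C> {}" "\<phi> \<D> {}" unfolding \<phi>_def using cl by (simp_all add: forms_perm_in_Nil)
      show "\<phi> \<C> S" if "S \<subseteq> T" "\<phi> \<C> T" for S T using \<phi>_mono cl(1) that by blast
      show "\<phi> \<D> S" if "S \<subseteq> T" "\<phi> \<D> T" for S T using \<phi>_mono cl(2) that by blast
      show "\<exists>S\<subseteq>T. finite S \<and> card S \<le> N \<and> \<not> \<phi> \<C> S" if "\<not> \<phi> \<C> T" for T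
        using \<phi>_small[OF NC _ that] unfolding N_def by simp
      show "\<exists>S\<subseteq>T. finite S \<and> card S \<le> N \<and> \<not> \<phi> \<D> S" if "\<not> \<phi> \<D> T" for T
        using \<phi>_small[OF ND _ that] unfolding N_def by simp
    qed simp
    have mono: "forms_perm_in (filter Q \<pi>) (Av {forbidden_pair inc}) \<longleftrightarrow>
      \<not> (\<exists>u\<in>set \<pi>. \<exists>v\<in>set \<pi>. bad inc u v \<and> Q u \<and> Q v)" for Q inc
    proof -
      have "(\<exists>ys. subseq ys (filter Q \<pi>) \<and> order_isomorphic ys (forbidden_pair inc)) \<longleftrightarrow>
        (\<exists>u v. subseq [u, v] (filter Q \<pi>) \<and> (if inc then v < u else u < v))"
        unfolding order_isomorphic_forbidden_pair by blast
      also have "\<dots> \<longleftrightarrow> (\<exists>u\<in>set \<pi>. \<exists>v\<in>set \<pi>. bad inc u v \<and> Q u \<and> Q v)"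
        unfolding subseq_pair_filter subseq_pair_iff_pos[OF d] bad_def by blast
      finally show ?thesis using forms_perm_in_Av[OF distinct_filter[OF d]] by (simp only:)
    qed
    \<comment> \<open>The translation between the two views: for a set of points, having a gridding
      means that some row admits a vertical line.\<close>
    have grd: "?grd (filter (\<lambda>v. v \<in> T) \<pi>) \<longleftrightarrow> \<not> (\<forall>h. no_cut T h)" if T: "T \<subseteq> set \<pi>" for T
    proof -
      have left: "left_fail T k h \<longleftrightarrow> \<not> (forms_perm_in (filter (\<lambda>y. y \<in> T \<and> h < y) (take k \<pi>)) \<C> \<and>
          forms_perm_in (filter (\<lambda>y. y \<in> T \<and> y \<le> h) (take k \<pi>)) (Av {forbidden_pair incE}))" for k h
        unfolding take_eq_filter_pos[OF d] mono left_fail_def \<phi>_def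
        using T by (auto simp: bad_def conj_ac)
      have pairs_right: "(\<exists>u\<in>T. \<exists>v\<in>T. bad incF u v \<and> k \<le> pos \<pi> u \<and> u \<le> h \<and> v \<le> h) \<longleftrightarrow>
          (\<exists>u\<in>set \<pi>. \<exists>v\<in>set \<pi>. bad incF u v \<and> ((u \<in> T \<and> u \<le> h) \<and> k \<le> pos \<pi> u) \<and>
            (v \<in> T \<and> v \<le> h) \<and> k \<le> pos \<pi> v)" for k h
      proof -
        have "k \<le> pos \<pi> v" if "bad incF u v" "k \<le> pos \<pi> u" for u v
          using that by (simp add: bad_def)
        then show ?thesis using T by blast
      qed
      have right: "right_fail T k h \<longleftrightarrow> \<not> (forms_perm_in (filter (\<lambda>y. y \<in> T \<and> h < y) (drop k \<pi>)) \<D> \<and>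
          forms_perm_in (filter (\<lambda>y. y \<in> T \<and> y \<le> h) (drop k \<pi>)) (Av {forbidden_pair incF}))" for k h
        unfolding take_eq_filter_pos[OF d] mono right_fail_def \<phi>_def
        unfolding pairs_right by (simp add: conj_ac)
      show ?thesis
        unfolding griddable_filter_iff no_cut_def left right by blast
    qed
    have "no_cut (set \<pi>) h" for h
      using grd[of "set \<pi>"] not_grd by simp
    then obtain T where T: "T \<subseteq> set \<pi>" "card T \<le> 4 * (4 + 2 * N)" "\<And>h. no_cut T h"
      using bounded_obstruction[OF inc] by blast
    define ys where "ys = filter (\<lambda>v. v \<in> T) \<pi>"
    have ys: "distinct ys" "set ys = T" "\<not> ?grd ys" "subseq ys \<pi>"
      using T grd[OF T(1)] d unfolding ys_def by auto
    obtain \<sigma> where \<sigma>: "\<sigma> \<in> perms" "order_isomorphic ys \<sigma>"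
      using ex_standardization[OF ys(1)] .
    \<comment> \<open>A gridding of \<open>\<sigma>\<close> would carry over to \<open>ys\<close>,
      whose entries come from \<open>\<pi>\<close> and so are positive.\<close>
    have "\<not> ?grd \<sigma>"
      using griddable_iso[OF perms_distinct[OF \<sigma>(1)] order_isomorphic_sym[OF \<sigma>(2)]]
        ys(2,3) T(1) pos_vals by blast
    then have "\<sigma> \<in> perms - ?G" using \<sigma>(1) by (simp add: Grid_iff)
    moreover have "contained_in \<sigma> \<pi>"
      using ys(4) \<sigma>(2) unfolding contained_in_def by blast
    moreover have "length \<sigma> \<le> 4 * (4 + 2 * N)"
      using \<sigma>(2) distinct_card[OF ys(1)] ys(2) T(2) unfolding order_isomorphic_def by simp
    ultimately show ?thesis by blast
  qed
  then have "finite (basis ?G)" by (rule finite_basisI)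
  moreover have "perm_class ?G"
    by (intro perm_class_Grid perm_class_Av cl) (simp_all add: forbidden_pair_def)
  ultimately show ?thesis unfolding finitely_based_class_def by blast
qed

theorem theorem2:
  fixes \<C> \<D> :: "nat list set"
  assumes "finitely_based_class \<C>" and "finitely_based_class \<D>"
  shows "finitely_based_class (Grid \<C> \<D> (Av {[2, 1]}) (Av {[2, 1]})) \<and>
         finitely_based_class (Grid \<C> \<D> (Av {[2, 1]}) (Av {[1, 2]})) \<and>
         finitely_based_class (Grid \<C> \<D> (Av {[1, 2]}) (Av {[2, 1]}))"
  using finitely_based_Grid_mono[OF assms, of True True] finitely_based_Grid_mono[OF assms, of True False]
    finitely_based_Grid_mono[OF assms, of False True]
  by (simp add: forbidden_pair_def)

end
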